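(* Let $\alpha > 0$ and $1 \leq p < \infty$. For $f \in A^\infty_\alpha$ set $$\tilde s_1(f) = \operatorname{dist}_{A^\infty_\alpha}(f, B^{p,\infty}_\alpha) = \inf_{g \in B^{p,\infty}_\alpha} \| f-g\|_{A^\infty_\alpha},$$ $$\tilde s_2(f) = \inf\left\{ \epsilon > 0 : \int_0^1 \chi_{\hat L_{\epsilon,\alpha}(f)}(r)\,(1-r)^{-1}\,dr < \infty \right\}.$$ Then $\tilde s_1(f) \asymp \tilde s_2(f)$, with constants depending only on $\alpha$, $p$ and $n$; that is, there is a constant $C \geq 1$ depending only on $\alpha,p,n$ such that $C^{-1}\tilde s_2(f) \leq \tilde s_1(f) \leq C \tilde s_2(f)$ for every $f \in A^\infty_\alpha$.
   Context: $\mathbb B$ is the open unit ball in $\mathbb R^n$, $\mathbb S = \partial\mathbb B$ is the unit sphere, and $h(\mathbb B)$ is the space of all harmonic functions on $\mathbb B$. For $f \in h(\mathbb B)$ and $0\le r<1$, $M_\infty(f,r) = \sup_{x'\in\mathbb S}|f(rx')|$. For $\alpha>0$ and $0<p<\infty$, $$A^\infty_\alpha = \Big\{ f\in h(\mathbb B): \|f\|_{A^\infty_\alpha} = \sup_{x\in\mathbb B} |f(x)|(1-|x|)^\alpha<\infty\Big\},$$ $$B^{p,\infty}_\alpha = \Big\{ f\in h(\mathbb B): \|f\|_{B^{p,\infty}_\alpha} = \Big(\int_0^1 M_\infty(f,r)^p(1-r)^{\alpha p-1}\,dr\Big)^{1/p}<\infty\Big\}.$$ One has $B^{p,\infty}_\alpha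 \subset A^\infty_\alpha$. For $\epsilon>0$, $\alpha>0$ and $f\in h(\mathbb B)$, $$\hat L_{\epsilon,\alpha}(f) = \{ r : 0\le r<1,\ M_\infty(f,r)(1-r)^\alpha \ge \epsilon\},$$ and $\chi_E$ denotes the characteristic function of a set $E$. *)

theory Defs
  imports "HOL-Analysis.Analysis"
begin

definition partial_deriv :: "('a::euclidean_space \<Rightarrow> real) \<Rightarrow> 'a \<Rightarrow> 'a \<Rightarrow> real" where
  "partial_deriv f b x = frechet_derivative f (at x) b"

definition laplacian :: "('a::euclidean_space \<Rightarrow> real) \<Rightarrow> 'a \<Rightarrow> real" where
  "laplacian f x = (\<Sum>b\<in>Basis. partial_deriv (partial_deriv f b) b x)"

text \<open>The following two definitions are meant for open sets \<open>U\<close> only.\<close>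

definition C2_on :: "'a::euclidean_space set \<Rightarrow> ('a \<Rightarrow> real) \<Rightarrow> bool" where
  "C2_on U f \<longleftrightarrow> f differentiable_on U \<and>
     (\<forall>b\<in>Basis. partial_deriv f b differentiable_on U \<and>
        (\<forall>c\<in>Basis. continuous_on U (partial_deriv (partial_deriv f b) c)))"

definition harmonic_on :: "'a::euclidean_space set \<Rightarrow> ('a \<Rightarrow> real) \<Rightarrow> bool" where
  "harmonic_on U f \<longleftrightarrow> C2_on U f \<and> (\<forall>x\<in>U. laplacian f x = 0)"

text \<open>Functions on the unit ball are represented by total functions; their values outside
  \<open>ball 0 1\<close> are arbitrary, and nothing below depends on them.\<close>

definition harmonic_ball :: "('a::euclidean_space \<Rightarrow> real) set" where
  "harmonic_ball = {f. harmonic_on (ball 0 1) f}"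

text \<open>For \<open>0 \<le> r < 1\<close> and \<open>f\<close> continuous on the ball, this is the supremum of a bounded set.\<close>

definition M_infty :: "('a::euclidean_space \<Rightarrow> real) \<Rightarrow> real \<Rightarrow> real" where
  "M_infty f r = (SUP x\<in>sphere 0 1. \<bar>f (r *\<^sub>R x)\<bar>)"

text \<open>Norms, distances and integrals take values in \<open>ennreal\<close>, so that finiteness is a genuine
  condition on them.\<close>

definition A_infty_norm :: "real \<Rightarrow> ('a::euclidean_space \<Rightarrow> real) \<Rightarrow> ennreal" where
  "A_infty_norm \<alpha> f = (SUP x\<in>ball 0 1. ennreal (\<bar>f x\<bar> * (1 - norm x) powr \<alpha>))"

definition A_infty :: "real \<Rightarrow> ('a::euclidean_space \<Rightarrow> real) set" where
  "A_infty \<alpha> = {f \<in> harmonic_ball. A_infty_norm \<alpha> f < \<infinity>}"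

text \<open>The \<open>p\<close>-th power of the norm of \<open>B_p_infty p \<alpha>\<close>; only its finiteness matters.\<close>

definition B_p_infty_norm_powr :: "real \<Rightarrow> real \<Rightarrow> ('a::euclidean_space \<Rightarrow> real) \<Rightarrow> ennreal" where
  "B_p_infty_norm_powr p \<alpha> f =
     (\<integral>\<^sup>+ r\<in>{0<..<1}. ennreal (M_infty f r powr p * (1 - r) powr (\<alpha> * p - 1)) \<partial>lborel)"

definition B_p_infty :: "real \<Rightarrow> real \<Rightarrow> ('a::euclidean_space \<Rightarrow> real) set" where
  "B_p_infty p \<alpha> = {f \<in> harmonic_ball. B_p_infty_norm_powr p \<alpha> f < \<infinity>}"

definition L_hat :: "real \<Rightarrow> real \<Rightarrow> ('a::euclidean_space \<Rightarrow> real) \<Rightarrow> real set" where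
  "L_hat \<epsilon> \<alpha> f = {r. 0 \<le> r \<and> r < 1 \<and> M_infty f r * (1 - r) powr \<alpha> \<ge> \<epsilon>}"

definition s1 :: "real \<Rightarrow> real \<Rightarrow> ('a::euclidean_space \<Rightarrow> real) \<Rightarrow> ennreal" where
  "s1 p \<alpha> f = (INF g\<in>B_p_infty p \<alpha>. A_infty_norm \<alpha> (\<lambda>x. f x - g x))"

definition s2 :: "real \<Rightarrow> ('a::euclidean_space \<Rightarrow> real) \<Rightarrow> ennreal" where
  "s2 \<alpha> f = (INF \<epsilon>\<in>{\<epsilon>::real. \<epsilon> > 0 \<and>
       (\<integral>\<^sup>+ r\<in>{0<..<1}. indicator (L_hat \<epsilon> \<alpha> f) r * ennreal (inverse (1 - r)) \<partial>lborel) < \<infinity>}.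
     ennreal \<epsilon>)"

end

theory Submission
  imports Defs
begin

text \<open>The bound \<open>s2 \<le> s1\<close> is Chebyshev's inequality: if \<open>g\<close> is within \<open>d < \<epsilon>\<close> of \<open>f\<close>, then
  \<open>M_infty g r * (1 - r) powr \<alpha> \<ge> \<epsilon> - d\<close> on \<open>L_hat \<epsilon> \<alpha> f\<close>. Conversely, \<open>M_infty f\<close> is increasing
  by the maximum principle. If \<open>L_hat \<epsilon> \<alpha> f\<close> has finite logarithmic measure, then for \<open>r\<close> near \<open>1\<close> the
  interval \<open>(r, (1 + r) / 2)\<close> contains a point outside it, so monotonicity gives
  \<open>M_infty f r * (1 - r) powr \<alpha> \<le> 2 powr \<alpha> * \<epsilon>\<close> for all \<open>r\<close> near \<open>1\<close>. Hence a dilate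
  \<open>\<lambda>x. f (\<rho> *\<^sub>R x)\<close> with \<open>\<rho>\<close> close to \<open>1\<close>, which is bounded and so lies in \<open>B_p_infty p \<alpha>\<close>, is within
  \<open>2 * 2 powr \<alpha> * \<epsilon>\<close> of \<open>f\<close>; no reproducing kernels are needed.\<close>

section \<open>Derivatives of harmonic functions and the maximum principle\<close>

text \<open>\<open>frechet_derivative\<close> is a choice among the derivatives at the point, and
  which maps qualify depends only on the germ of the function. This lets a formula for a first
  derivative that is known only on an open set be differentiated again.\<close>

lemma frechet_derivative_cong_open:
  fixes f g :: "'a::real_normed_vector \<Rightarrow> 'b::real_normed_vector"
  assumes "open U" "x \<in> U" "\<And>y. y \<in> U \<Longrightarrow> f y = g y"
  shows "frechet_derivative f (at x) = frechet_derivative g (at x)"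
proof -
  have "(f has_derivative D) (at x) \<longleftrightarrow> (g has_derivative D) (at x)" for D
    using has_derivative_transform_within_open[of f D x UNIV U g]
      has_derivative_transform_within_open[of g D x UNIV U f] assms by auto
  then show ?thesis by (simp add: frechet_derivative_def)
qed

lemma harmonic_on_partial_deriv:
  fixes f :: "'a::euclidean_space \<Rightarrow> real"
  assumes "harmonic_on U f" "open U" "x \<in> U"
  shows "(f has_derivative (\<lambda>h. frechet_derivative f (at x) h)) (at x)"
    and "b \<in> Basis \<Longrightarrow> (partial_deriv f b has_derivative
           (\<lambda>h. frechet_derivative (partial_deriv f b) (at x) h)) (at x)"
  using assms
  by (auto simp: harmonic_on_def C2_on_def differentiable_on_eq_differentiable_at
      simp flip: frechet_derivative_works)

text \<open>Chain rule along a line. Used for a function and then for its partial derivative, it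
  reduces the second derivative test to one real variable.\<close>

lemma has_derivative_line:
  fixes f :: "'a::euclidean_space \<Rightarrow> real"
  assumes "(f has_derivative frechet_derivative f (at (x + t *\<^sub>R b))) (at (x + t *\<^sub>R b))"
  shows "((\<lambda>t. f (x + t *\<^sub>R b)) has_real_derivative partial_deriv f b (x + t *\<^sub>R b)) (at t)"
proof -
  have "((\<lambda>t. x + t *\<^sub>R b) has_derivative (\<lambda>h. h *\<^sub>R b)) (at t)"
    by (auto intro!: derivative_eq_intros)
  from has_derivative_compose[OF this assms]
  have "((\<lambda>t. f (x + t *\<^sub>R b)) has_derivative
      (\<lambda>h. frechet_derivative f (at (x + t *\<^sub>R b)) (h *\<^sub>R b))) (at t)" .
  moreover have "frechet_derivative f (at (x + t *\<^sub>R b)) (h *\<^sub>R b)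
      = h * partial_deriv f b (x + t *\<^sub>R b)" for h
    using linear_cmul[OF has_derivative_linear[OF assms]] by (simp add: partial_deriv_def)
  ultimately show ?thesis
    by (simp add: has_field_derivative_def mult_commute_abs)
qed

text \<open>Adding \<open>c * (x \<bullet> x)\<close> makes the Laplacian strictly positive, which the second derivative test
  forbids at an interior maximum.\<close>

lemma harmonic_perturbed_no_interior_max:
  fixes f :: "'a::euclidean_space \<Rightarrow> real"
  assumes f: "harmonic_on U f" and U: "open U" "x \<in> U" and "c > 0"
    and d: "d > 0" and max: "\<And>y. dist x y < d \<Longrightarrow> f y + c * (y \<bullet> y) \<le> f x + c * (x \<bullet> x)"
  shows False
proof -
  obtain e where e: "e > 0" "ball x e \<subseteq> U" "e \<le> d"
    using U d openE[of U x] by (metis ball_subset_ball_iff min.cobounded1 min.cobounded2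
        min_less_iff_conj subset_ball subset_trans)
  \<comment> \<open>This sum is the Laplacian of the perturbed function at \<open>x\<close>; being
    positive, it has a positive summand, which selects the direction \<open>b\<close>.\<close>
  have "(\<Sum>b\<in>Basis. partial_deriv (partial_deriv f b) b x + 2 * c) > 0"
  proof -
    have "(\<Sum>b\<in>Basis. partial_deriv (partial_deriv f b) b x) = 0"
      using f U by (simp add: harmonic_on_def laplacian_def)
    then show ?thesis using \<open>c > 0\<close> by (simp add: sum.distrib)
  qed
  then obtain b :: 'a where b: "b \<in> Basis" "partial_deriv (partial_deriv f b) b x + 2 * c > 0"
    by (metis (no_types, lifting) not_less sum_nonpos)
  define h where "h t = f (x + t *\<^sub>R b) + c * ((x + t *\<^sub>R b) \<bullet> (x + t *\<^sub>R b))" for t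
  define h' where "h' t = partial_deriv f b (x + t *\<^sub>R b) + 2 * c * ((x + t *\<^sub>R b) \<bullet> b)" for t
  have inU: "x + t *\<^sub>R b \<in> U" if "\<bar>t\<bar> < e" for t
    using e that b by (auto simp: dist_norm intro!: subsetD[OF e(2)])
  have h: "(h has_real_derivative h' t) (at t)" if "\<bar>t\<bar> < e" for t
    unfolding h_def h'_def
    by (auto intro!: derivative_eq_intros
        has_derivative_line harmonic_on_partial_deriv(1)[OF f U(1) inU[OF that]]
        has_derivative_inner[THEN has_derivative_imp_has_field_derivative]
        simp: algebra_simps inner_commute)
  have h1: "(h' has_real_derivative (partial_deriv (partial_deriv f b) b (x + 0 *\<^sub>R b) + 2 * c)) (at 0)"
  proof -
    have "((\<lambda>t. (x + t *\<^sub>R b) \<bullet> b) has_real_derivative 1) (at 0)"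
      using b by (auto intro!: derivative_eq_intros simp: inner_add_left)
    moreover have "((\<lambda>t. partial_deriv f b (x + t *\<^sub>R b)) has_real_derivative
       partial_deriv (partial_deriv f b) b (x + 0 *\<^sub>R b)) (at 0)"
      by (rule has_derivative_line[of "partial_deriv f b"])
        (use harmonic_on_partial_deriv(2)[OF f U b(1)] in auto)
    ultimately show ?thesis
      unfolding h'_def by (auto intro!: derivative_eq_intros)
  qed
  have max0: "h t \<le> h 0" if "\<bar>t\<bar> < e" for t
    using max[of "x + t *\<^sub>R b"] that e(3) b by (simp add: h_def dist_norm)
  \<comment> \<open>A critical point with positive second derivative: \<open>h'\<close> is positive
    just to the right of 0, so \<open>h\<close> rises above its supposed maximum
    \<open>h 0\<close>.\<close>
  have "h' 0 = 0"
    using DERIV_local_max[OF h[of 0] e(1)] max0 e by auto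
  from DERIV_pos_inc_right[OF h1] b
  obtain \<delta> where \<delta>: "\<delta> > 0" "\<And>t. 0 < t \<Longrightarrow> t < \<delta> \<Longrightarrow> h' t > 0"
    using \<open>h' 0 = 0\<close> by auto
  define s where "s = min \<delta> e / 2"
  have s: "0 < s" "s < \<delta>" "s < e" using \<delta> e by (auto simp: s_def)
  have "h 0 < h s"
  proof (rule DERIV_pos_imp_increasing_open[OF s(1)])
    show "\<exists>y. (h has_real_derivative y) (at t) \<and> 0 < y" if "0 < t" "t < s" for t
      using h[of t] \<delta>(2)[of t] that s by auto
    show "continuous_on {0..s} h"
    proof (intro continuous_at_imp_continuous_on ballI)
      show "isCont h t" if "t \<in> {0..s}" for t
        using h[of t] that s DERIV_isCont by force
    qed
  qed
  with max0[of s] s show False by simp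
qed

lemma harmonic_on_continuous:
  "harmonic_on U f \<Longrightarrow> continuous_on U f"
  by (auto simp: harmonic_on_def C2_on_def differentiable_imp_continuous_on)

text \<open>The perturbed function \<open>u\<close> attains its maximum over the compact ball, and
  the previous lemma forces the maximum point onto the sphere. There \<open>u\<close> exceeds
  \<open>f\<close> by only \<open>c * r\<^sup>2\<close>, which can be made arbitrarily
  small.\<close>

lemma harmonic_max_principle:
  fixes f :: "'a::euclidean_space \<Rightarrow> real"
  assumes f: "harmonic_on U f" and U: "open U" "cball 0 r \<subseteq> U"
    and M: "\<And>y. norm y = r \<Longrightarrow> f y \<le> M" and x: "norm x \<le> r"
  shows "f x \<le> M"
proof (rule field_le_epsilon)
  fix e :: real assume "e > 0"
  \<comment> \<open>The added 1 keeps the denominator positive when \<open>r\<close> is 0.\<close>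
  define c where "c = e / (r\<^sup>2 + 1)"
  have r1: "r\<^sup>2 + 1 > 0" by (smt (verit) zero_le_power2)
  have c: "c > 0" "c * r\<^sup>2 \<le> e"
    using \<open>e > 0\<close> r1 by (auto simp: c_def field_simps)
  define u where "u y = f y + c * (y \<bullet> y)" for y
  have "continuous_on (cball 0 r) u"
    unfolding u_def by (intro continuous_intros continuous_on_subset[OF harmonic_on_continuous[OF f] U(2)])
  moreover have "cball (0::'a) r \<noteq> {}" using order_trans[OF norm_ge_zero x] by simp
  ultimately obtain z where z: "norm z \<le> r" "\<And>y. norm y \<le> r \<Longrightarrow> u y \<le> u z"
    using continuous_attains_sup[of "cball 0 r" u] by auto
  have "norm z = r"
  proof (rule ccontr)
    assume "norm z \<noteq> r"
    then have d: "r - norm z > 0" using z by simp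
    show False
    proof (rule harmonic_perturbed_no_interior_max[OF f U(1) _ c(1) d])
      show "z \<in> U" using z U by auto
      fix y assume "dist z y < r - norm z"
      then have "norm y \<le> r" using norm_triangle_sub[of y z] by (simp add: dist_norm norm_minus_commute)
      then show "f y + c * (y \<bullet> y) \<le> f z + c * (z \<bullet> z)" using z(2) by (simp add: u_def)
    qed
  qed
  have "f x \<le> u x" using c by (simp add: u_def)
  also have "\<dots> \<le> u z" using z x by simp
  also have "\<dots> = f z + c * r\<^sup>2" using \<open>norm z = r\<close> by (simp add: u_def dot_square_norm)
  finally show "f x \<le> M + e" using M[OF \<open>norm z = r\<close>] c by simp
qed

section \<open>Scaling of harmonic functions\<close>

text \<open>Each differentiation brings out one factor \<open>\<rho>\<close>, so the Laplacian is
  multiplied by \<open>a * \<rho> * \<rho>\<close>. The case \<open>\<rho> = 1\<close> supplies sign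
  changes, the case \<open>a = 1\<close> the dilates.\<close>

lemma harmonic_on_compose_scale:
  fixes f :: "'a::euclidean_space \<Rightarrow> real"
  assumes f: "harmonic_on U f" and U: "open U" and V: "open V" "(*\<^sub>R) \<rho> ` V \<subseteq> U"
  shows "harmonic_on V (\<lambda>x. a * f (\<rho> *\<^sub>R x))"
proof -
  have scale: "((\<lambda>x. a * g (\<rho> *\<^sub>R x)) has_derivative (\<lambda>h. a * \<rho> * frechet_derivative g (at (\<rho> *\<^sub>R x)) h)) (at x)"
    if "(g has_derivative (\<lambda>h. frechet_derivative g (at (\<rho> *\<^sub>R x)) h)) (at (\<rho> *\<^sub>R x))"
    for g :: "'a \<Rightarrow> real" and a x
  proof -
    have "((\<lambda>x. \<rho> *\<^sub>R x) has_derivative (\<lambda>h. \<rho> *\<^sub>R h)) (at x)"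
      by (auto intro!: derivative_eq_intros)
    from has_derivative_mult_right[OF has_derivative_compose[OF this that], of a]
    show ?thesis
      using linear_cmul[OF has_derivative_linear[OF that]] by (simp add: mult.assoc)
  qed
  have VU: "\<rho> *\<^sub>R x \<in> U" if "x \<in> V" for x using V that by auto
  note d1 = scale[OF harmonic_on_partial_deriv(1)[OF f U VU]]
  note d2 = scale[OF harmonic_on_partial_deriv(2)[OF f U VU]]
  have p1: "partial_deriv (\<lambda>x. a * f (\<rho> *\<^sub>R x)) b x = a * \<rho> * partial_deriv f b (\<rho> *\<^sub>R x)"
    if "x \<in> V" for b x
    using frechet_derivative_at[OF d1[OF that]] by (simp add: partial_deriv_def) metis
  have diff: "partial_deriv (\<lambda>x. a * f (\<rho> *\<^sub>R x)) b differentiable (at x)"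
    if "x \<in> V" "b \<in> Basis" for b x
  proof (rule differentiableI)
    show "(partial_deriv (\<lambda>x. a * f (\<rho> *\<^sub>R x)) b has_derivative
      (\<lambda>h. a * \<rho> * \<rho> * frechet_derivative (partial_deriv f b) (at (\<rho> *\<^sub>R x)) h)) (at x)"
      by (rule has_derivative_transform_within_open[OF d2[OF that, of "a * \<rho>"] V(1) that(1)])
        (simp add: p1)
  qed
  have p2: "partial_deriv (partial_deriv (\<lambda>x. a * f (\<rho> *\<^sub>R x)) b) c x
      = a * \<rho> * \<rho> * partial_deriv (partial_deriv f b) c (\<rho> *\<^sub>R x)"
    if "x \<in> V" "b \<in> Basis" for b c x
    unfolding partial_deriv_def[of "partial_deriv _ _"]
    by (subst frechet_derivative_cong_open[OF V(1) that(1), of _ "\<lambda>x. a * \<rho> * partial_deriv f b (\<rho> *\<^sub>R x)"])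
      (simp_all add: p1 frechet_derivative_at[OF d2[OF that], symmetric])
  have cont: "continuous_on V (partial_deriv (partial_deriv (\<lambda>x. a * f (\<rho> *\<^sub>R x)) b) c)"
    if "b \<in> Basis" "c \<in> Basis" for b c
  proof -
    have "continuous_on U (partial_deriv (partial_deriv f b) c)"
      using f that by (simp add: harmonic_on_def C2_on_def)
    then have "continuous_on V (\<lambda>x. a * \<rho> * \<rho> * partial_deriv (partial_deriv f b) c (\<rho> *\<^sub>R x))"
      by (intro continuous_intros continuous_on_compose2[OF _ _ V(2)])
    then show ?thesis using p2[OF _ that(1)] by (simp cong: continuous_on_cong)
  qed
  have "laplacian (\<lambda>x. a * f (\<rho> *\<^sub>R x)) x = 0" if "x \<in> V" for x
  proof -
    have "laplacian (\<lambda>x. a * f (\<rho> *\<^sub>R x)) x = a * \<rho> * \<rho> * laplacian f (\<rho> *\<^sub>R x)"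
      using p2[OF that] by (simp add: laplacian_def sum_distrib_left)
    then show ?thesis using f VU[OF that] by (simp add: harmonic_on_def)
  qed
  moreover have "(\<lambda>x. a * f (\<rho> *\<^sub>R x)) differentiable_on V"
    unfolding differentiable_on_eq_differentiable_at[OF V(1)]
    using d1 by (blast intro: differentiableI)
  ultimately show ?thesis
    using diff cont V(1) by (auto simp: harmonic_on_def C2_on_def differentiable_on_eq_differentiable_at)
qed

section \<open>The maximum modulus on spheres\<close>

lemma bdd_above_M_infty:
  fixes f :: "'a::euclidean_space \<Rightarrow> real"
  assumes "continuous_on (ball 0 1) f" "0 \<le> r" "r < 1"
  shows "bdd_above ((\<lambda>x. \<bar>f (r *\<^sub>R x)\<bar>) ` sphere 0 1)"
proof -
  have "continuous_on (sphere 0 1) (\<lambda>x. \<bar>f (r *\<^sub>R x)\<bar>)"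
    using assms by (intro continuous_intros continuous_on_compose2[OF assms(1)]) auto
  then show ?thesis
    by (intro bounded_imp_bdd_above compact_imp_bounded compact_continuous_image) auto
qed

lemma abs_le_M_infty:
  fixes f :: "'a::euclidean_space \<Rightarrow> real"
  assumes "continuous_on (ball 0 1) f" "norm x < 1"
  shows "\<bar>f x\<bar> \<le> M_infty f (norm x)"
proof -
  obtain z where z: "norm z = 1" "x = norm x *\<^sub>R z"
  proof (cases "x = 0")
    case True
    then show ?thesis using that vector_choose_size[of 1] by (metis norm_zero scale_zero_left zero_le_one)
  next
    case False
    then show ?thesis using that[of "x /\<^sub>R norm x"] by simp
  qed
  have "\<bar>f (norm x *\<^sub>R z)\<bar> \<le> M_infty f (norm x)"
    unfolding M_infty_def using z
    by (intro cSUP_upper bdd_above_M_infty[OF assms(1)] assms) auto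
  then show ?thesis using z by simp
qed

lemma M_infty_le:
  fixes f :: "'a::euclidean_space \<Rightarrow> real"
  assumes "0 \<le> r" "\<And>x. norm x = r \<Longrightarrow> \<bar>f x\<bar> \<le> c"
  shows "M_infty f r \<le> c"
  unfolding M_infty_def using assms by (intro cSUP_least) auto

text \<open>The maximum principle for \<open>f\<close> and for its negative, with the factor
  \<open>c\<close> being 1 or -1, controls the absolute value.\<close>

lemma abs_le_M_infty_of_norm_le:
  fixes f :: "'a::euclidean_space \<Rightarrow> real"
  assumes f: "f \<in> harmonic_ball" and x: "norm x \<le> r" "r < 1"
  shows "\<bar>f x\<bar> \<le> M_infty f r"
proof -
  have h: "harmonic_on (ball 0 1) (\<lambda>x. c * f x)" for c
    using harmonic_on_compose_scale[of "ball 0 1" f "ball 0 1" 1 c] f by (simp add: harmonic_ball_def)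
  have "c * f x \<le> M_infty f r" if c: "\<bar>c\<bar> = 1" for c
  proof (rule harmonic_max_principle[OF h])
    show "c * f y \<le> M_infty f r" if "norm y = r" for y
    proof -
      have "\<bar>f y\<bar> \<le> M_infty f r"
        using abs_le_M_infty[OF harmonic_on_continuous, of f y] f x that by (simp add: harmonic_ball_def)
      moreover have "c * f y \<le> \<bar>f y\<bar>"
        using c by (metis abs_ge_self abs_mult mult_1)
      ultimately show ?thesis by simp
    qed
  qed (use x in auto)
  from this[of 1] this[of "-1"] show ?thesis by auto
qed

lemma mono_on_M_infty:
  fixes f :: "'a::euclidean_space \<Rightarrow> real"
  assumes f: "f \<in> harmonic_ball"
  shows "mono_on {0..<1} (M_infty f)"
  using abs_le_M_infty_of_norm_le[OF f] by (auto intro!: mono_onI M_infty_le)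

lemma M_infty_nonneg:
  fixes f :: "'a::euclidean_space \<Rightarrow> real"
  assumes f: "f \<in> harmonic_ball" "0 \<le> r" "r < 1"
  shows "0 \<le> M_infty f r"
  using abs_le_M_infty_of_norm_le[OF f(1), of 0 r] assms by simp

text \<open>Monotone functions are Borel. The indicator confines the claim to radii below 1, since
  the values of \<open>f\<close> outside the ball are arbitrary.\<close>

lemma borel_measurable_M_infty:
  fixes f :: "'a::euclidean_space \<Rightarrow> real"
  assumes f: "f \<in> harmonic_ball"
  shows "(\<lambda>r. M_infty f r * indicator {0..<1} r) \<in> borel_measurable borel"
  using borel_measurable_mono_on_fnc[OF mono_on_M_infty[OF f]]
  by (simp add: borel_measurable_restrict_space_iff mult.commute)

section \<open>Lower bound for the distance by Chebyshev's inequality\<close>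

lemma A_infty_norm_bound:
  fixes f :: "'a::euclidean_space \<Rightarrow> real"
  assumes "norm x < 1" "A_infty_norm \<alpha> f \<le> ennreal d" "0 \<le> d"
  shows "\<bar>f x\<bar> * (1 - norm x) powr \<alpha> \<le> d"
proof -
  have "ennreal (\<bar>f x\<bar> * (1 - norm x) powr \<alpha>) \<le> A_infty_norm \<alpha> f"
    unfolding A_infty_norm_def using assms by (intro SUP_upper) auto
  also note assms(2)
  finally show ?thesis using assms(3) by simp
qed

lemma M_infty_le_add_A_infty_norm:
  fixes f g :: "'a::euclidean_space \<Rightarrow> real"
  assumes g: "g \<in> harmonic_ball" and d: "A_infty_norm \<alpha> (\<lambda>x. f x - g x) \<le> ennreal d" "0 \<le> d"
    and r: "0 \<le> r" "r < 1"
  shows "M_infty f r * (1 - r) powr \<alpha> \<le> M_infty g r * (1 - r) powr \<alpha> + d"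
proof -
  have "M_infty f r \<le> M_infty g r + d / (1 - r) powr \<alpha>"
  proof (rule M_infty_le[OF r(1)])
    fix x :: 'a assume x: "norm x = r"
    have "\<bar>f x - g x\<bar> \<le> d / (1 - r) powr \<alpha>"
      using A_infty_norm_bound[OF _ d, of x] x r by (simp add: field_simps)
    moreover have "\<bar>g x\<bar> \<le> M_infty g r"
      using abs_le_M_infty_of_norm_le[OF g, of x r] x r by simp
    ultimately show "\<bar>f x\<bar> \<le> M_infty g r + d / (1 - r) powr \<alpha>" by linarith
  qed
  then show ?thesis using r by (simp add: field_simps)
qed

text \<open>On \<open>L_hat \<epsilon> \<alpha> f\<close> the weighted maximum modulus of
  \<open>g\<close> is at least \<open>\<epsilon> - d > 0\<close>. Taking p-th powers bounds
  \<open>inverse (1 - r)\<close> by a constant times the integrand of the norm of \<open>g\<close>,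
  so \<open>\<epsilon>\<close> is admissible in the infimum \<open>s2\<close>.\<close>

lemma s2_le_of_A_infty_norm_less:
  fixes f g :: "'a::euclidean_space \<Rightarrow> real"
  assumes p: "p > 0" and g: "g \<in> B_p_infty p \<alpha>"
    and d: "A_infty_norm \<alpha> (\<lambda>x. f x - g x) \<le> ennreal d" "0 \<le> d" and \<epsilon>: "d < \<epsilon>"
  shows "s2 \<alpha> f \<le> ennreal \<epsilon>"
proof -
  have gh: "g \<in> harmonic_ball" using g by (simp add: B_p_infty_def)
  note [measurable] = borel_measurable_M_infty[OF gh]
  define c where "c = (\<epsilon> - d) powr p"
  have c: "c > 0" using \<epsilon> by (simp add: c_def)
  \<comment> \<open>The integrand of the norm of \<open>g\<close>, with the indicator inserted to
    make it Borel on the whole line; it is unchanged on the unit interval.\<close>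
  define G where "G r = (M_infty g r * indicator {0..<1} r) powr p * (1 - r) powr (\<alpha> * p - 1)" for r
  have [measurable]: "G \<in> borel_measurable borel"
    unfolding G_def by measurable
  have le: "indicator (L_hat \<epsilon> \<alpha> f) r * ennreal (inverse (1 - r)) \<le> ennreal (inverse c) * ennreal (G r)"
    if r: "r \<in> {0<..<1}" for r
  proof (cases "r \<in> L_hat \<epsilon> \<alpha> f")
    case True
    let ?m = "M_infty g r"
    have m: "?m \<ge> 0" using M_infty_nonneg[OF gh] r by simp
    have "\<epsilon> - d \<le> ?m * (1 - r) powr \<alpha>"
      using True M_infty_le_add_A_infty_norm[OF gh d, of r] by (simp add: L_hat_def)
    then have "c \<le> (?m * (1 - r) powr \<alpha>) powr p"
      unfolding c_def using \<epsilon> p by (intro powr_mono2) auto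
    also have "\<dots> = G r * (1 - r)"
      using r m by (simp add: G_def powr_mult powr_powr powr_diff)
    finally have "inverse (1 - r) \<le> inverse c * G r"
      using r c by (simp add: field_simps)
    then show ?thesis
      using True c by (simp add: ennreal_mult'[symmetric] ennreal_leI)
  qed simp
  have "(\<integral>\<^sup>+ r\<in>{0<..<1}. indicator (L_hat \<epsilon> \<alpha> f) r * ennreal (inverse (1 - r)) \<partial>lborel)
      \<le> (\<integral>\<^sup>+ r. ennreal (inverse c) * (ennreal (G r) * indicator {0<..<1} r) \<partial>lborel)"
    using le by (intro nn_integral_mono) (auto split: split_indicator)
  also have "\<dots> = ennreal (inverse c) * (\<integral>\<^sup>+ r\<in>{0<..<1}. ennreal (G r) \<partial>lborel)"
    by (rule nn_integral_cmult) simp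
  also have "(\<integral>\<^sup>+ r\<in>{0<..<1}. ennreal (G r) \<partial>lborel) = B_p_infty_norm_powr p \<alpha> g"
    unfolding B_p_infty_norm_powr_def G_def
    by (intro nn_integral_cong) (auto split: split_indicator)
  also have "ennreal (inverse c) * \<dots> < \<infinity>"
    using g by (simp add: B_p_infty_def ennreal_mult_less_top)
  finally show ?thesis
    unfolding s2_def using d \<epsilon> by (intro INF_lower) simp
qed

lemma s2_le_s1:
  fixes f :: "'a::euclidean_space \<Rightarrow> real"
  assumes "p > 0"
  shows "s2 \<alpha> f \<le> s1 p \<alpha> f"
  unfolding s1_def
proof (rule INF_greatest)
  fix g :: "'a \<Rightarrow> real" assume g: "g \<in> B_p_infty p \<alpha>"
  show "s2 \<alpha> f \<le> A_infty_norm \<alpha> (\<lambda>x. f x - g x)"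
  \<comment> \<open>Only a finite norm \<open>d\<close> has to be treated, and the slack
    \<open>e\<close> gives the strict inequality \<open>d < d + e\<close> required by the previous
    lemma.\<close>
  proof (rule ennreal_le_epsilon)
    fix e :: real assume fin: "A_infty_norm \<alpha> (\<lambda>x. f x - g x) < top" and e: "0 < e"
    define d where "d = enn2real (A_infty_norm \<alpha> (\<lambda>x. f x - g x))"
    have d: "A_infty_norm \<alpha> (\<lambda>x. f x - g x) = ennreal d" "0 \<le> d"
      unfolding d_def using fin by simp_all
    show "s2 \<alpha> f \<le> A_infty_norm \<alpha> (\<lambda>x. f x - g x) + ennreal e"
      using s2_le_of_A_infty_norm_less[OF assms g, of f d "d + e"] d e by simp
  qed
qed

section \<open>Bounded harmonic functions and sets of finite logarithmic measure\<close>

text \<open>The reflection of \<open>r\<close> to \<open>1 - r\<close> turns the integral into that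
  of \<open>x powr (a - 1)\<close> near 0, which converges because the exponent exceeds -1.\<close>

lemma nn_integral_one_minus_powr_finite:
  fixes a :: real
  assumes "a > 0"
  shows "(\<integral>\<^sup>+ r\<in>{0<..<1}. ennreal ((1 - r) powr (a - 1)) \<partial>lborel) < \<infinity>"
proof -
  have "((\<lambda>x::real. x powr (a - 1)) has_integral (1 powr (a - 1 + 1) / (a - 1 + 1))) {0..1}"
    by (rule has_integral_powr_from_0) (use assms in auto)
  moreover have "(\<lambda>x::real. if x \<in> {0..1} then x powr (a - 1) else 0)
      = (\<lambda>x. x powr (a - 1) * indicator {0..1} x)"
    by (auto split: split_indicator)
  ultimately have "((\<lambda>x::real. x powr (a - 1) * indicator {0..1} x) has_integral
      (1 powr (a - 1 + 1) / (a - 1 + 1))) UNIV"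
    by (metis has_integral_restrict_UNIV)
  then have "(\<integral>\<^sup>+ x. ennreal (x powr (a - 1) * indicator {0..1} x) \<partial>lborel) < \<infinity>"
    by (subst nn_integral_has_integral_lborel) auto
  also have "(\<integral>\<^sup>+ x. ennreal (x powr (a - 1) * indicator {0..1} x) \<partial>lborel)
      = (\<integral>\<^sup>+ r. ennreal ((1 - r) powr (a - 1) * indicator {0..1} (1 - r)) \<partial>lborel)"
    using nn_integral_real_affine[of "\<lambda>x. ennreal (x powr (a - 1) * indicator {0..1} x)" "-1" 1] by simp
  finally show ?thesis
    by (rule le_less_trans[rotated]) (auto intro!: nn_integral_mono split: split_indicator)
qed

text \<open>The bound \<open>K\<close> passes to \<open>M_infty f\<close>, and the remaining weight
  is integrable because \<open>\<alpha> * p > 0\<close>.\<close>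

lemma bounded_harmonic_in_B_p_infty:
  fixes f :: "'a::euclidean_space \<Rightarrow> real"
  assumes "f \<in> harmonic_ball" and K: "\<And>x. norm x < 1 \<Longrightarrow> \<bar>f x\<bar> \<le> K" and "\<alpha> > 0" "p > 0"
  shows "f \<in> B_p_infty p \<alpha>"
proof -
  have "B_p_infty_norm_powr p \<alpha> f
      \<le> (\<integral>\<^sup>+ r. ennreal (K powr p) * (ennreal ((1 - r) powr (\<alpha> * p - 1)) * indicator {0<..<1} r) \<partial>lborel)"
    unfolding B_p_infty_norm_powr_def
  proof (intro nn_integral_mono, clarsimp split: split_indicator)
    fix r :: real assume r: "0 < r" "r < 1"
    have "M_infty f r powr p \<le> K powr p"
      using r assms by (intro powr_mono2 M_infty_le M_infty_nonneg) auto
    then show "ennreal (M_infty f r powr p * (1 - r) powr (\<alpha> * p - 1))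
        \<le> ennreal (K powr p) * ennreal ((1 - r) powr (\<alpha> * p - 1))"
      by (simp add: ennreal_mult'[symmetric] ennreal_leI mult_right_mono)
  qed
  also have "\<dots> = ennreal (K powr p) *
      (\<integral>\<^sup>+ r\<in>{0<..<1}. ennreal ((1 - r) powr (\<alpha> * p - 1)) \<partial>lborel)"
    by (rule nn_integral_cmult) simp
  also have "\<dots> < \<infinity>"
    using nn_integral_one_minus_powr_finite[of "\<alpha> * p"] assms by (simp add: ennreal_mult_less_top)
  finally show ?thesis using assms by (simp add: B_p_infty_def)
qed

text \<open>The intervals \<open>(r, (1 + r) / 2)\<close> have logarithmic measure at least \<open>1 / 2\<close>.\<close>

lemma finite_log_measure_misses:
  fixes L :: "real set"
  assumes L: "L \<in> sets borel"
    and fin: "(\<integral>\<^sup>+ r\<in>{0<..<1}. indicator L r * ennreal (inverse (1 - r)) \<partial>lborel) < \<infinity>"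
  obtains r0 where "0 < r0" "r0 < 1" "\<And>r. r0 \<le> r \<Longrightarrow> r < 1 \<Longrightarrow> \<exists>t\<in>{r<..<(1 + r) / 2}. t \<notin> L"
proof -
  note [measurable] = L
  \<comment> \<open>Logarithmic measure restricted to \<open>L\<close>. As a measure, finite on the
    unit interval, it is continuous from above along the tails \<open>A k\<close>, which shrink to
    the empty set.\<close>
  define D where "D = density lborel (\<lambda>r. indicator L r * ennreal (inverse (1 - r)))"
  \<comment> \<open>The shift by 2 keeps the left endpoints at least 1/2, so every tail lies in the
    unit interval and the resulting \<open>r0\<close> is positive.\<close>
  define A where "A k = {1 - 1 / real (k + 2)<..<1::real}" for k :: nat
  have A01: "A k \<subseteq> {0<..<1}" for k
    by (auto simp: A_def) (smt (verit) divide_le_eq_1_pos of_nat_0_le_iff)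
  have D: "emeasure D S = (\<integral>\<^sup>+ r\<in>S. indicator L r * ennreal (inverse (1 - r)) \<partial>lborel)"
    if "S \<in> sets borel" for S
    unfolding D_def using that by (simp add: emeasure_density)
  have "(\<lambda>k. emeasure D (A k)) \<longlonglongrightarrow> emeasure D (\<Inter>k. A k)"
  proof (rule Lim_emeasure_decseq)
    show "range A \<subseteq> sets D" by (auto simp: D_def A_def)
    show "decseq A" by (auto simp: decseq_def A_def) (smt (verit) frac_le of_nat_0_le_iff of_nat_mono)
    fix k
    have "emeasure D (A k) \<le> emeasure D {0<..<1}"
      by (rule emeasure_mono[OF A01]) (simp add: D_def)
    then show "emeasure D (A k) \<noteq> \<infinity>"
      using fin by (auto simp: D top_unique)
  qed
  moreover have "(\<Inter>k. A k) = {}"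
  proof (rule ccontr)
    assume "(\<Inter>k. A k) \<noteq> {}"
    then obtain r where r: "\<And>k. r \<in> A k" by auto
    then have "1 - r > 0" by (simp add: A_def)
    then obtain k :: nat where "inverse (real (Suc k)) < 1 - r" using reals_Archimedean by blast
    moreover have "1 / real (k + 2) \<le> inverse (real (Suc k))" by (simp add: field_simps)
    ultimately show False using r[of k] by (simp add: A_def)
  qed
  ultimately have "(\<lambda>k. emeasure D (A k)) \<longlonglongrightarrow> 0" by simp
  then have "\<forall>\<^sub>F k in sequentially. emeasure D (A k) < ennreal (1 / 2)"
    by (rule order_tendstoD) (unfold ennreal_less_zero_iff, simp)
  then obtain k where k: "emeasure D (A k) < ennreal (1 / 2)"
    by (auto simp: eventually_sequentially)
  show ?thesis
  proof
    show "0 < 1 - 1 / real (k + 2)" "1 - 1 / real (k + 2) < 1" by auto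
    fix r assume r: "1 - 1 / real (k + 2) \<le> r" "r < 1"
    show "\<exists>t\<in>{r<..<(1 + r) / 2}. t \<notin> L"
    proof (rule ccontr)
      assume "\<not> ?thesis"
      then have sub: "{r<..<(1 + r) / 2} \<subseteq> L" by auto
      \<comment> \<open>The interval has length \<open>(1 - r) / 2\<close> and the density of
        \<open>D\<close> on it is at least \<open>inverse (1 - r)\<close>. The product 1/2 is
        independent of \<open>r\<close> and contradicts the choice of the tail.\<close>
      have "ennreal (1 / 2) = ennreal (inverse (1 - r)) * emeasure lborel {r<..<(1 + r) / 2}"
        using r by (simp add: ennreal_mult'[symmetric] field_simps)
      also have "\<dots> = (\<integral>\<^sup>+ t. ennreal (inverse (1 - r)) * indicator {r<..<(1 + r) / 2} t \<partial>lborel)"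
        by (simp add: nn_integral_cmult_indicator)
      also have "\<dots> \<le> (\<integral>\<^sup>+ t\<in>{r<..<(1 + r) / 2}. indicator L t * ennreal (inverse (1 - t)) \<partial>lborel)"
        using sub r by (intro nn_integral_mono)
          (auto split: split_indicator intro!: ennreal_leI le_imp_inverse_le)
      also have "\<dots> = emeasure D {r<..<(1 + r) / 2}" by (simp add: D)
      also have "\<dots> \<le> emeasure D (A k)"
        using r by (intro emeasure_mono) (auto simp: A_def D_def)
      finally show False using k by simp
    qed
  qed
qed

section \<open>Growth near the boundary and approximation by dilates\<close>

lemma L_hat_measurable:
  fixes f :: "'a::euclidean_space \<Rightarrow> real"
  assumes f: "f \<in> harmonic_ball"
  shows "L_hat \<epsilon> \<alpha> f \<in> sets borel"
proof -
  note [measurable] = borel_measurable_M_infty[OF f]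
  have "L_hat \<epsilon> \<alpha> f = {0..<1} \<inter> {r. \<epsilon> \<le> M_infty f r * indicator {0..<1} r * (1 - r) powr \<alpha>}"
    by (auto simp: L_hat_def)
  also have "\<dots> \<in> sets borel" by measurable
  finally show ?thesis .
qed

lemma growth_of_finite_log_measure:
  fixes f :: "'a::euclidean_space \<Rightarrow> real"
  assumes f: "f \<in> harmonic_ball" and "\<alpha> > 0"
    and fin: "(\<integral>\<^sup>+ r\<in>{0<..<1}. indicator (L_hat \<epsilon> \<alpha> f) r * ennreal (inverse (1 - r)) \<partial>lborel) < \<infinity>"
  obtains r0 where "0 < r0" "r0 < 1"
    "\<And>r. r0 \<le> r \<Longrightarrow> r < 1 \<Longrightarrow> M_infty f r * (1 - r) powr \<alpha> \<le> 2 powr \<alpha> * \<epsilon>"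
proof -
  obtain r0 where r0: "0 < r0" "r0 < 1"
    "\<And>r. r0 \<le> r \<Longrightarrow> r < 1 \<Longrightarrow> \<exists>t\<in>{r<..<(1 + r) / 2}. t \<notin> L_hat \<epsilon> \<alpha> f"
    using finite_log_measure_misses[OF L_hat_measurable[OF f] fin] by metis
  show ?thesis
  proof
    fix r assume r: "r0 \<le> r" "r < 1"
    then obtain t where t: "r < t" "t < (1 + r) / 2" "t \<notin> L_hat \<epsilon> \<alpha> f"
      using r0(3)[of r] by auto
    have t1: "0 \<le> t" "t < 1" using t r r0 by auto
    \<comment> \<open>Passing to the larger radius \<open>t\<close> increases
      \<open>M_infty f\<close>, while \<open>t < (1 + r) / 2\<close> gives
      \<open>1 - r < 2 * (1 - t)\<close>; this is the source of the factor
      \<open>2 powr \<alpha>\<close>.\<close>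
    have "M_infty f r * (1 - r) powr \<alpha> \<le> M_infty f t * (2 * (1 - t)) powr \<alpha>"
    proof (rule mult_mono)
      show "M_infty f r \<le> M_infty f t"
        using mono_onD[OF mono_on_M_infty[OF f], of r t] r r0 t t1 by auto
      show "(1 - r) powr \<alpha> \<le> (2 * (1 - t)) powr \<alpha>"
        using t r \<open>\<alpha> > 0\<close> by (intro powr_mono2) auto
    qed (use M_infty_nonneg[OF f t1] in auto)
    also have "\<dots> = 2 powr \<alpha> * (M_infty f t * (1 - t) powr \<alpha>)"
      using t1 by (simp only: powr_mult mult_ac)
    also have "\<dots> \<le> 2 powr \<alpha> * \<epsilon>"
      using t(3) t1 by (intro mult_left_mono) (auto simp: L_hat_def)
    finally show "M_infty f r * (1 - r) powr \<alpha> \<le> 2 powr \<alpha> * \<epsilon>" .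
  qed (use r0 in auto)
qed

text \<open>Uniform continuity on the compact ball of radius \<open>r\<close>: dilation keeps points
  in that ball and moves them by at most \<open>1 - \<rho>\<close>.\<close>

lemma uniform_dilation_approx:
  fixes f :: "'a::euclidean_space \<Rightarrow> real"
  assumes f: "continuous_on (ball 0 1) f" and "r < 1" "\<epsilon> > 0"
  obtains \<rho> where "0 < \<rho>" "\<rho> < 1" "\<And>x. norm x \<le> r \<Longrightarrow> \<bar>f x - f (\<rho> *\<^sub>R x)\<bar> \<le> \<epsilon>"
proof -
  have "continuous_on (cball 0 r) f"
    using f assms by (auto elim!: continuous_on_subset)
  then have "uniformly_continuous_on (cball 0 r) f"
    by (rule compact_uniformly_continuous) simp
  then obtain d where d: "d > 0"
    "\<And>x y. norm x \<le> r \<Longrightarrow> norm y \<le> r \<Longrightarrow> dist y x < d \<Longrightarrow> dist (f y) (f x) < \<epsilon>"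
    using \<open>\<epsilon> > 0\<close> unfolding uniformly_continuous_on_def by (metis mem_cball_0)
  \<comment> \<open>The bound 1/2 keeps \<open>\<rho>\<close> positive when \<open>d\<close> is
    large.\<close>
  define \<rho> where "\<rho> = max (1 / 2) (1 - d / 2)"
  have \<rho>: "0 < \<rho>" "\<rho> < 1" "1 - \<rho> < d" using d by (auto simp: \<rho>_def)
  show ?thesis
  proof
    fix x :: 'a assume x: "norm x \<le> r"
    have "norm (\<rho> *\<^sub>R x) \<le> norm x" using \<rho> by (simp add: mult_left_le_one_le)
    moreover have "dist x (\<rho> *\<^sub>R x) < d"
    proof -
      have "x - \<rho> *\<^sub>R x = (1 - \<rho>) *\<^sub>R x" by (simp add: algebra_simps)
      then have "dist x (\<rho> *\<^sub>R x) = (1 - \<rho>) * norm x" using \<rho> by (simp add: dist_norm)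
      also have "\<dots> \<le> 1 - \<rho>" using x \<open>r < 1\<close> \<rho> by (intro mult_left_le) auto
      finally show ?thesis using \<rho> by simp
    qed
    ultimately show "\<bar>f x - f (\<rho> *\<^sub>R x)\<bar> \<le> \<epsilon>"
      using d(2)[of "\<rho> *\<^sub>R x" x] x by (simp add: dist_real_def)
  qed (use \<rho> in auto)
qed

text \<open>The radius \<open>r0\<close> is fixed first and \<open>\<rho>\<close> is chosen for it.
  Inside radius \<open>r0\<close> uniform approximation gives an error of at most
  \<open>\<epsilon>\<close>. Outside it, \<open>f\<close> and its dilate are both bounded by
  \<open>M_infty f (norm x)\<close>, so the growth bound enters twice.\<close>

lemma s1_le_of_finite_log_measure:
  fixes f :: "'a::euclidean_space \<Rightarrow> real"
  assumes f: "f \<in> harmonic_ball" and \<alpha>: "\<alpha> > 0" and p: "p > 0" and \<epsilon>: "\<epsilon> > 0"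
    and fin: "(\<integral>\<^sup>+ r\<in>{0<..<1}. indicator (L_hat \<epsilon> \<alpha> f) r * ennreal (inverse (1 - r)) \<partial>lborel) < \<infinity>"
  shows "s1 p \<alpha> f \<le> ennreal (2 * 2 powr \<alpha> * \<epsilon>)"
proof -
  obtain r0 where r0: "0 < r0" "r0 < 1"
    "\<And>r. r0 \<le> r \<Longrightarrow> r < 1 \<Longrightarrow> M_infty f r * (1 - r) powr \<alpha> \<le> 2 powr \<alpha> * \<epsilon>"
    using growth_of_finite_log_measure[OF f \<alpha> fin] by metis
  have fh: "harmonic_on (ball 0 1) f" using f by (simp add: harmonic_ball_def)
  obtain \<rho> where \<rho>: "0 < \<rho>" "\<rho> < 1" "\<And>x. norm x \<le> r0 \<Longrightarrow> \<bar>f x - f (\<rho> *\<^sub>R x)\<bar> \<le> \<epsilon>"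
    using uniform_dilation_approx[OF harmonic_on_continuous[OF fh] r0(2) \<epsilon>] by metis
  define g where "g x = f (\<rho> *\<^sub>R x)" for x
  have shrink: "norm (\<rho> *\<^sub>R x) \<le> norm x" for x :: 'a
    using \<rho> by (simp add: mult_left_le_one_le)
  have "harmonic_on (ball 0 1) (\<lambda>x. 1 * f (\<rho> *\<^sub>R x))"
    by (rule harmonic_on_compose_scale[OF fh])
      (use le_less_trans[OF shrink] in \<open>auto simp del: norm_scaleR\<close>)
  then have "g \<in> harmonic_ball" by (simp add: harmonic_ball_def g_def[abs_def])
  \<comment> \<open>The dilate samples \<open>f\<close> only within radius
    \<open>\<rho> < 1\<close>, where \<open>f\<close> is bounded.\<close>
  moreover have "\<bar>g x\<bar> \<le> M_infty f \<rho>" if "norm x < 1" for x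
    unfolding g_def using \<rho> that by (intro abs_le_M_infty_of_norm_le[OF f]) (auto simp: mult_left_le)
  ultimately have g: "g \<in> B_p_infty p \<alpha>"
    by (intro bounded_harmonic_in_B_p_infty \<alpha> p)
  have "A_infty_norm \<alpha> (\<lambda>x. f x - g x) \<le> ennreal (2 * 2 powr \<alpha> * \<epsilon>)"
    unfolding A_infty_norm_def
  proof (intro SUP_least ennreal_leI)
    fix x :: 'a assume "x \<in> ball 0 1"
    then have x: "norm x < 1" by simp
    show "\<bar>f x - g x\<bar> * (1 - norm x) powr \<alpha> \<le> 2 * 2 powr \<alpha> * \<epsilon>"
    proof (cases "norm x \<le> r0")
      case True
      have "\<bar>f x - g x\<bar> * (1 - norm x) powr \<alpha> \<le> \<epsilon> * 1"
        using \<rho>(3)[OF True] x \<alpha> \<epsilon> by (intro mult_mono) (auto simp: g_def intro: powr_le1)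
      also have "\<dots> \<le> 2 * 2 powr \<alpha> * \<epsilon>"
        using \<epsilon> \<alpha> ge_one_powr_ge_zero[of 2 \<alpha>] by simp
      finally show ?thesis .
    next
      case False
      have "\<bar>f x\<bar> \<le> M_infty f (norm x)" "\<bar>g x\<bar> \<le> M_infty f (norm x)"
        using abs_le_M_infty_of_norm_le[OF f, of _ "norm x"] x shrink[of x] by (auto simp: g_def)
      then have "\<bar>f x - g x\<bar> * (1 - norm x) powr \<alpha> \<le> 2 * M_infty f (norm x) * (1 - norm x) powr \<alpha>"
        by (intro mult_right_mono) auto
      also have "\<dots> \<le> 2 * 2 powr \<alpha> * \<epsilon>"
        using r0(3)[of "norm x"] False x by simp
      finally show ?thesis .
    qed
  qed
  then show ?thesis
    unfolding s1_def using g by (intro INF_lower2)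
qed

theorem theorem2p3:
  fixes \<alpha> p :: real
  assumes "\<alpha> > 0" and "1 \<le> p"
  shows "\<exists>C::real. C \<ge> 1 \<and>
    (\<forall>f \<in> (A_infty \<alpha> :: (real ^ 'n \<Rightarrow> real) set).
       ennreal (inverse C) * s2 \<alpha> f \<le> s1 p \<alpha> f \<and> s1 p \<alpha> f \<le> ennreal C * s2 \<alpha> f)"
proof -
  \<comment> \<open>The constant comes from the upper bound; the lower bound already holds with
    constant 1.\<close>
  define C :: real where "C = 2 * 2 powr \<alpha>"
  have C: "C \<ge> 1" using assms ge_one_powr_ge_zero[of 2 \<alpha>] by (simp add: C_def)
  have "ennreal (inverse C) * s2 \<alpha> f \<le> s1 p \<alpha> f \<and> s1 p \<alpha> f \<le> ennreal C * s2 \<alpha> f"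
    if "f \<in> A_infty \<alpha>" for f :: "real ^ 'n \<Rightarrow> real"
  proof
    have f: "f \<in> harmonic_ball" using that by (simp add: A_infty_def)
    have "ennreal (inverse C) * s2 \<alpha> f \<le> 1 * s2 \<alpha> f"
      using C by (intro mult_right_mono) (auto simp: inverse_le_1_iff)
    also have "\<dots> \<le> s1 p \<alpha> f" using s2_le_s1[of p] assms by simp
    finally show "ennreal (inverse C) * s2 \<alpha> f \<le> s1 p \<alpha> f" .
    have cancel: "ennreal C * ennreal (inverse C) = 1" "ennreal (inverse C) * ennreal C = 1"
      using C by (simp_all add: ennreal_mult'[symmetric])
    \<comment> \<open>With the constant moved to the left, the claim is a lower bound for an infimum
      and can be checked for each admissible \<open>\<epsilon>\<close>.\<close>
    have "ennreal (inverse C) * s1 p \<alpha> f \<le> s2 \<alpha> f"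
      unfolding s2_def
    proof (rule INF_greatest, clarify)
      fix \<epsilon> :: real
      assume "0 < \<epsilon>" "(\<integral>\<^sup>+ r\<in>{0<..<1}. indicator (L_hat \<epsilon> \<alpha> f) r * ennreal (inverse (1 - r)) \<partial>lborel) < \<infinity>"
      then have "s1 p \<alpha> f \<le> ennreal C * ennreal \<epsilon>"
        using s1_le_of_finite_log_measure[OF f, of \<alpha> p \<epsilon>] assms C
        by (simp add: C_def ennreal_mult'[symmetric])
      then have "ennreal (inverse C) * s1 p \<alpha> f \<le> ennreal (inverse C) * (ennreal C * ennreal \<epsilon>)"
        by (rule mult_left_mono) simp
      then show "ennreal (inverse C) * s1 p \<alpha> f \<le> ennreal \<epsilon>"
        by (simp add: mult.assoc[symmetric] cancel)
    qed
    then have "ennreal C * (ennreal (inverse C) * s1 p \<alpha> f) \<le> ennreal C * s2 \<alpha> f"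
      by (rule mult_left_mono) simp
    then show "s1 p \<alpha> f \<le> ennreal C * s2 \<alpha> f"
      by (simp add: mult.assoc[symmetric] cancel)
  qed
  then show ?thesis using C by blast
qed

end
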